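(* Let $\mathcal{P}\subset\mathbb{R}^n$ be a convex polyhedron and let $p\notin\mathcal{P}$. Let $F,K$ be faces of $\mathcal{P}$ with $K$ a proper face of $F$, and let $e\in K^\circ$. If there is an escape from $e$ toward $p$ along $F$, then there is an escape from $e$ toward $p$ along either $K$ or some face $K'\in\mathcal{F}_1(K)$.
   Context: All distances and orthogonal projections are Euclidean. A polyhedron is the solution set of a finite system of (non-strict) linear inequalities and equalities. $\mathcal{A}(X)$ denotes the affine hull of a set $X$. Faces are nonempty, and $\mathcal{P}$ is counted as a face of itself. $K^\circ$ denotes the relative interior of $K$ (its interior in $\mathcal{A}(K)$). For a face $K$ of $\mathcal{P}$, $\mathcal{F}_1(K)$ is the set of all faces $G$ of $\mathcal{P}$ with $K\subseteq G$ and $\dim G-\dim K=1$. Escape: let $e\in F$ where $F$ is a face of $\mathcal{P}$, and let $\pi_F$ be the orthogonal projection of $p$ onto $\mathcal{A}(F)$. An escape from $e$ toward $p$ along $F$ is a point $e'\neq e$ such that $e'=e+t_0(\pi_F-e)$, where $t_0\in(0,1]$ is largest such that $e+t_0(\pi_F-e)\in\mathcal{P}$. (Thus there is no escape along $F$ if $\pi_F=e$ or if $e+t(\pi_F-e)\notin\mathcal{P}$ for all $t\in(0,1]$.) *)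

theory Defs
  imports "HOL-Analysis.Analysis"
begin

text \<open>
  Faces of a convex set as in \<^const>\<open>face_of\<close>, except that the empty face is excluded;
  the set itself is a face of itself.
\<close>

definition nonempty_face :: "'a::euclidean_space set \<Rightarrow> 'a set \<Rightarrow> bool" where
  "nonempty_face P F \<longleftrightarrow> F face_of P \<and> F \<noteq> {}"

definition faces1 :: "'a::euclidean_space set \<Rightarrow> 'a set \<Rightarrow> 'a set set" where
  "faces1 P K = {G. nonempty_face P G \<and> K \<subseteq> G \<and> aff_dim G - aff_dim K = 1}"

text \<open>Orthogonal projection of a point onto a nonempty affine subspace \<open>A\<close>.\<close>

definition orth_proj :: "'a::euclidean_space set \<Rightarrow> 'a \<Rightarrow> 'a" where
  "orth_proj A p = (THE x. x \<in> A \<and> (\<forall>y\<in>A. orthogonal (p - x) (y - x)))"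

lemma orth_proj_unique:
  assumes "x \<in> A" "\<forall>y\<in>A. orthogonal (p - x) (y - x)"
    and "x' \<in> A" "\<forall>y\<in>A. orthogonal (p - x') (y - x')"
  shows "x = x'"
proof -
  have "(p - x) \<bullet> (x' - x) = 0" "(p - x') \<bullet> (x - x') = 0"
    using assms by (auto simp: orthogonal_def)
  then have "(x - x') \<bullet> (x - x') = 0"
    by (simp add: inner_diff_left inner_diff_right inner_commute)
  then show ?thesis by simp
qed

lemma closest_point_affine_orthogonal:
  fixes A :: "'a::euclidean_space set"
  assumes A: "affine A" "A \<noteq> {}" and y: "y \<in> A"
  shows "orthogonal (p - closest_point A p) (y - closest_point A p)"
proof -
  let ?x = "closest_point A p"
  have cl: "closed A" and cv: "convex A"
    by (simp_all add: A affine_closed affine_imp_convex)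
  have x: "?x \<in> A"
    using cl A(2) by (rule closest_point_in_set)
  have "2 *\<^sub>R ?x - y \<in> A"
    using mem_affine[OF A(1) x y, of 2 "-1"] by simp
  from closest_point_dot[OF cv cl this, of p] closest_point_dot[OF cv cl y, of p]
  show ?thesis
    by (simp add: orthogonal_def inner_diff_right scaleR_2 inner_add_right)
qed

lemma orth_proj_eq_closest_point:
  assumes "affine A" "A \<noteq> {}"
  shows "orth_proj A p = closest_point A p"
  unfolding orth_proj_def
  using closest_point_affine_orthogonal[OF assms] assms affine_closed
  by (intro the_equality) (blast intro: closest_point_in_set orth_proj_unique)+

text \<open>
  \<open>is_escape P F p e e'\<close>: the point \<open>e'\<close> is an escape from \<open>e\<close> toward \<open>p\<close> along the face \<open>F\<close>
  of \<open>P\<close>.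
\<close>

definition is_escape ::
    "'a::euclidean_space set \<Rightarrow> 'a set \<Rightarrow> 'a \<Rightarrow> 'a \<Rightarrow> 'a \<Rightarrow> bool" where
  "is_escape P F p e e' \<longleftrightarrow>
     nonempty_face P F \<and> e \<in> F \<and> e' \<noteq> e \<and>
     (\<exists>t0\<in>{0<..1}. e' = e + t0 *\<^sub>R (orth_proj (affine hull F) p - e) \<and>
        e + t0 *\<^sub>R (orth_proj (affine hull F) p - e) \<in> P \<and>
        (\<forall>t\<in>{0<..1}. e + t *\<^sub>R (orth_proj (affine hull F) p - e) \<in> P \<longrightarrow> t \<le> t0))"

end

theory Submission
  imports Defs
begin

text \<open>
  If \<open>p\<close> does not project to \<open>e\<close> on the affine hull of \<open>K\<close>, there is an escape along \<open>K\<close> because \<open>e\<close> is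
  in the relative interior. Otherwise \<open>f x = (p - e) \<bullet> (x - e)\<close> vanishes on \<open>K\<close>, while an escape
  along \<open>F\<close> provides a point of \<open>P\<close> with \<open>f > 0\<close>. Take a face \<open>G \<supseteq> K\<close> of minimal dimension on which
  \<open>f\<close> takes a positive value, say at \<open>y\<close>. If its dimension exceeded that of \<open>K\<close> by two or more, a
  facet of \<open>G\<close> would contain some \<open>z \<notin> K\<close> with \<open>f z \<le> 0\<close>; moving from \<open>y\<close> in direction \<open>e - z\<close>
  within the tangent cone of \<open>G\<close> at \<open>e\<close> does not decrease \<open>f\<close> and ends on a smaller face through \<open>K\<close>.
  So \<open>G \<in> faces1 P K\<close>, and modulo the directions of \<open>K\<close> the projection of \<open>p - e\<close> to \<open>G\<close> is a
  positive multiple of \<open>y - e\<close>.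
\<close>

section \<open>Escapes and orthogonal projections\<close>

text \<open>Convexity shrinks any positive step to one of length at most 1, and compactness then
  supplies the largest such step. The maximality demanded by \<open>is_escape\<close> need not be
  tracked afterwards.\<close>

lemma ex_escape_iff:
  fixes P F :: "'a::euclidean_space set"
  assumes "closed P" "convex P" "nonempty_face P F" "e \<in> F"
  shows "(\<exists>e'. is_escape P F p e e') \<longleftrightarrow>
    orth_proj (affine hull F) p \<noteq> e \<and>
    (\<exists>t>0. e + t *\<^sub>R (orth_proj (affine hull F) p - e) \<in> P)"
    (is "_ \<longleftrightarrow> ?\<pi> \<noteq> e \<and> ?R")
proof
  assume "\<exists>e'. is_escape P F p e e'"
  then show "?\<pi> \<noteq> e \<and> ?R"
    by (auto simp: is_escape_def)
next
  assume R: "?\<pi> \<noteq> e \<and> ?R"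
  then obtain s where s: "s > 0" "e + s *\<^sub>R (?\<pi> - e) \<in> P"
    by blast
  have "e \<in> P"
    using assms by (auto simp: nonempty_face_def dest: face_of_imp_subset)
  define s' where "s' = min s 1"
  have s': "0 < s'" "s' \<le> 1" "s' \<le> s"
    using s by (auto simp: s'_def)
  have "(1 - s'/s) *\<^sub>R e + (s'/s) *\<^sub>R (e + s *\<^sub>R (?\<pi> - e)) \<in> P"
    using \<open>convex P\<close> \<open>e \<in> P\<close> s s' by (intro convexD) auto
  moreover have "(1 - s'/s) *\<^sub>R e + (s'/s) *\<^sub>R (e + s *\<^sub>R (?\<pi> - e)) = e + s' *\<^sub>R (?\<pi> - e)"
    using s by (simp add: algebra_simps)
  ultimately have s'P: "e + s' *\<^sub>R (?\<pi> - e) \<in> P"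
    by simp
  \<comment> \<open>Including 0 makes \<open>?T\<close> compact; its maximum is still positive
    because \<open>s'\<close> belongs to it.\<close>
  let ?T = "{0..1} \<inter> (\<lambda>t. e + t *\<^sub>R (?\<pi> - e)) -` P"
  have "closed ?T"
    by (intro continuous_closed_preimage continuous_intros \<open>closed P\<close> closed_atLeastAtMost)
  then have "compact ?T"
    by (metis compact_Icc compact_Int_closed inf.left_idem)
  moreover have "s' \<in> ?T"
    using s' s'P by simp
  ultimately obtain t where t: "t \<in> ?T" "\<And>u. u \<in> ?T \<Longrightarrow> u \<le> t"
    using compact_attains_sup[of ?T] by blast
  have "s' \<le> t"
    using s' s'P by (intro t) auto
  then have "is_escape P F p e (e + t *\<^sub>R (?\<pi> - e))"
    unfolding is_escape_def using assms R t s' by (intro conjI bexI[of _ t]) auto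
  then show "\<exists>e'. is_escape P F p e e'"
    by blast
qed

lemma orth_proj_affine:
  fixes A :: "'a::euclidean_space set"
  assumes "affine A" "A \<noteq> {}"
  shows "orth_proj A p \<in> A" "\<And>y. y \<in> A \<Longrightarrow> (p - orth_proj A p) \<bullet> (y - orth_proj A p) = 0"
  using closest_point_affine_orthogonal[OF assms] closest_point_in_set[OF affine_closed assms(2)] assms
  by (auto simp: orth_proj_eq_closest_point orthogonal_def)

text \<open>The difference of \<open>p\<close> and its projection is orthogonal to every direction
  of \<open>A\<close>, so in products with such directions \<open>p\<close> may be replaced by its
  projection.\<close>

lemma orth_proj_diff_inner:
  fixes A :: "'a::euclidean_space set"
  assumes "affine A" "e \<in> A" "y \<in> A"
  shows "(p - e) \<bullet> (y - e) = (orth_proj A p - e) \<bullet> (y - e)"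
proof -
  have "(p - orth_proj A p) \<bullet> ((y - orth_proj A p) - (e - orth_proj A p)) = 0"
    using assms by (subst inner_diff_right, subst (1 2) orth_proj_affine(2)) auto
  then show ?thesis
    by (simp add: inner_diff_left inner_diff_right)
qed

lemma rel_interior_step:
  fixes K :: "'a::euclidean_space set"
  assumes "e \<in> rel_interior K" "x \<in> affine hull K"
  obtains t where "t > 0" "e + t *\<^sub>R (x - e) \<in> K"
proof -
  obtain \<epsilon> where \<epsilon>: "\<epsilon> > 0" "cball e \<epsilon> \<inter> affine hull K \<subseteq> K" and "e \<in> K"
    using assms(1) by (auto simp: mem_rel_interior_cball)
  \<comment> \<open>The summand 1 keeps the denominator positive when \<open>x = e\<close>.\<close>
  define t where "t = \<epsilon> / (norm (x - e) + 1)"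
  have t: "t > 0"
    using \<epsilon> by (simp add: t_def add_nonneg_pos)
  have "norm (x - e) < norm (x - e) + 1"
    by simp
  then have "t * norm (x - e) \<le> \<epsilon>"
    using \<epsilon> unfolding t_def
    by (simp add: divide_simps add_nonneg_pos)
  then have "e + t *\<^sub>R (x - e) \<in> cball e \<epsilon>"
    using t by (simp add: dist_norm)
  moreover have "e + t *\<^sub>R (x - e) \<in> affine hull K"
    using mem_affine[of "affine hull K" e x "1 - t" t] assms(2) \<open>e \<in> K\<close>
    by (simp add: algebra_simps hull_inc)
  ultimately show ?thesis
    using that t \<epsilon> by blast
qed

section \<open>Tangent cones and faces of a polyhedron\<close>

text \<open>The tangent cone of a polyhedron at \<open>e\<close> is cut out by the normals of the constraints active at \<open>e\<close>.\<close>

lemma polyhedron_tangent_cone: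
  fixes P :: "'a::euclidean_space set"
  assumes "polyhedron P" "e \<in> P"
  obtains A where "finite A" "\<And>a x. a \<in> A \<Longrightarrow> x \<in> P \<Longrightarrow> a \<bullet> (x - e) \<le> 0"
    "\<And>d. (\<And>a. a \<in> A \<Longrightarrow> a \<bullet> d \<le> 0) \<Longrightarrow> \<exists>t>0. e + t *\<^sub>R d \<in> P"
proof -
  obtain H where H: "finite H" "P = \<Inter>H" "\<And>h. h \<in> H \<Longrightarrow> \<exists>a b. h = {x. a \<bullet> x \<le> b}"
    using assms(1) unfolding polyhedron_def by metis
  then obtain a b where ab: "\<And>h. h \<in> H \<Longrightarrow> h = {x. a h \<bullet> x \<le> b h}"
    by metis
  have P: "x \<in> P \<longleftrightarrow> (\<forall>h\<in>H. a h \<bullet> x \<le> b h)" for x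
    using ab H(2) by blast
  show thesis
  proof
    show "finite (a ` {h\<in>H. a h \<bullet> e = b h})"
      using H by simp
    show "c \<bullet> (x - e) \<le> 0" if "c \<in> a ` {h\<in>H. a h \<bullet> e = b h}" "x \<in> P" for c x
      using that P by (auto simp: inner_diff_right)
    fix d assume d: "\<And>c. c \<in> a ` {h\<in>H. a h \<bullet> e = b h} \<Longrightarrow> c \<bullet> d \<le> 0"
    \<comment> \<open>An active constraint does not increase along \<open>d\<close>; an inactive one
      is strict at \<open>e\<close> and stays satisfied for small \<open>t\<close> by
      continuity.\<close>
    have "\<forall>\<^sub>F t in at_right 0. a h \<bullet> (e + t *\<^sub>R d) \<le> b h" if h: "h \<in> H" for h
    proof (cases "a h \<bullet> e = b h")
      case True
      then have "a h \<bullet> d \<le> 0"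
        using d h by blast
      then show ?thesis
        using True by (intro eventually_at_rightI[of 0 1]) (auto simp: inner_add_right mult_nonneg_nonpos)
    next
      case False
      then have "a h \<bullet> e < b h"
        using P h assms(2) by force
      moreover have "((\<lambda>t. a h \<bullet> (e + t *\<^sub>R d)) \<longlongrightarrow> a h \<bullet> (e + 0 *\<^sub>R d)) (at_right 0)"
        by (intro tendsto_intros)
      ultimately show ?thesis
        by (auto dest: order_tendstoD(2) elim!: eventually_mono)
    qed
    then have "\<forall>\<^sub>F t in at_right 0. \<forall>h\<in>H. a h \<bullet> (e + t *\<^sub>R d) \<le> b h"
      using H(1) by (simp add: eventually_ball_finite_distrib)
    then have "\<forall>\<^sub>F t in at_right 0. t > 0 \<and> e + t *\<^sub>R d \<in> P"
      using eventually_at_right_less[of "0::real"] unfolding P by eventually_elim auto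
    then show "\<exists>t>0. e + t *\<^sub>R d \<in> P"
      using eventually_happens'[of "at_right (0::real)"] by fastforce
  qed
qed

text \<open>A ratio test as in the simplex method: multiples of \<open>z - e\<close> are subtracted
  from \<open>y - e\<close> until the first constraint that is active at \<open>e\<close> but strict
  at \<open>z\<close> becomes tight. The hyperplane of that constraint cuts out
  \<open>H\<close>.\<close>

lemma polyhedron_move_to_face:
  fixes S :: "'a::euclidean_space set"
  assumes S: "polyhedron S" and K: "K face_of S" "e \<in> rel_interior K"
    and z: "z \<in> S" "z \<notin> K" and y: "y \<in> S"
  obtains H c t where "H face_of S" "K \<subseteq> H" "z \<notin> H" "c \<ge> 0" "t > 0"
    "e + t *\<^sub>R ((y - e) - c *\<^sub>R (z - e)) \<in> H"
proof -
  have eK: "e \<in> K"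
    using K(2) rel_interior_subset by blast
  then have eS: "e \<in> S"
    using K(1) face_of_imp_subset by blast
  from polyhedron_tangent_cone[OF S eS] obtain A where A: "finite A"
    "\<And>a x. a \<in> A \<Longrightarrow> x \<in> S \<Longrightarrow> a \<bullet> (x - e) \<le> 0"
    "\<And>d. (\<And>a. a \<in> A \<Longrightarrow> a \<bullet> d \<le> 0) \<Longrightarrow> \<exists>t>0. e + t *\<^sub>R d \<in> S"
    by metis
  define B where "B = {a\<in>A. a \<bullet> (z - e) < 0}"
  \<comment> \<open>Otherwise a small step from \<open>e\<close> away from \<open>z\<close> stays in
    \<open>S\<close>. Then \<open>e\<close> lies inside a segment of \<open>S\<close> ending at
    \<open>z\<close>, which forces \<open>z\<close> into the face \<open>K\<close>.\<close>
  have "B \<noteq> {}"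
  proof
    assume "B = {}"
    then have "a \<bullet> (e - z) \<le> 0" if "a \<in> A" for a
      using that by (force simp: B_def inner_diff_right)
    then obtain t where t: "t > 0" "e + t *\<^sub>R (e - z) \<in> S"
      using A(3) by blast
    have "z \<noteq> e"
      using z eK by blast
    have "e = (1 - t/(1+t)) *\<^sub>R (e + t *\<^sub>R (e - z)) + (t/(1+t)) *\<^sub>R z"
    proof -
      have "(1 + t) *\<^sub>R e = (1 + t) *\<^sub>R ((1 - t/(1+t)) *\<^sub>R (e + t *\<^sub>R (e - z)) + (t/(1+t)) *\<^sub>R z)"
        using t by (simp add: scaleR_add_right field_simps)
      then show ?thesis
        using t by (subst (asm) scaleR_cancel_left) auto
    qed
    moreover have "e + t *\<^sub>R (e - z) \<noteq> z"
    proof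
      assume "e + t *\<^sub>R (e - z) = z"
      then have "(1 + t) *\<^sub>R (e - z) = 0"
        by (simp add: algebra_simps)
      then show False
        using t \<open>z \<noteq> e\<close> by auto
    qed
    ultimately have "e \<in> open_segment (e + t *\<^sub>R (e - z)) z"
      unfolding in_segment using t by (intro conjI exI[of _ "t/(1+t)"]) auto
    then show False
      using K(1) t z eK unfolding face_of_def by blast
  qed
  \<comment> \<open>Since \<open>a \<bullet> (z - e)\<close> is negative on \<open>B\<close>, the
    constraint \<open>a\<close> tolerates the multiple \<open>c\<close> exactly when
    \<open>c \<le> r a\<close>. The least ratio is therefore the largest admissible
    \<open>c\<close>.\<close>
  define r where "r = (\<lambda>a. (a \<bullet> (y - e)) / (a \<bullet> (z - e)))"
  have "finite B"
    using A by (simp add: B_def)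
  then obtain b where b: "b \<in> B" and bmin: "\<And>a. a \<in> B \<Longrightarrow> r b \<le> r a"
    using \<open>B \<noteq> {}\<close> ex_is_arg_min_if_finite[of B r] by (auto simp: is_arg_min_linorder)
  have bA: "b \<in> A" "b \<bullet> (z - e) < 0"
    using b by (auto simp: B_def)
  let ?q = "(y - e) - r b *\<^sub>R (z - e)"
  have r0: "r b \<ge> 0"
    using A(2)[OF bA(1) y] bA(2) by (simp add: r_def divide_nonpos_neg)
  have bq: "b \<bullet> ?q = 0"
    using bA by (simp add: r_def inner_diff_right[of b "y - e"])
  have "a \<bullet> ?q \<le> 0" if a: "a \<in> A" for a
  proof (cases "a \<in> B")
    case True
    then have "a \<bullet> (z - e) < 0"
      by (simp add: B_def)
    then show ?thesis
      using bmin[OF True] unfolding r_def inner_diff_right[of a "y - e"]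
      by (simp add: neg_le_divide_eq)
  next
    case False
    then have "a \<bullet> (z - e) = 0"
      using A(2)[OF a z(1)] a by (auto simp: B_def)
    then show ?thesis
      using A(2)[OF a y] by (simp add: inner_diff_right[of a "y - e"])
  qed
  then obtain t where t: "t > 0" "e + t *\<^sub>R ?q \<in> S"
    using A(3) by blast
  define H where "H = S \<inter> {x. b \<bullet> x = b \<bullet> e}"
  have H: "H face_of S"
    unfolding H_def using A(2)[OF bA(1)]
    by (intro face_of_Int_supporting_hyperplane_le polyhedron_imp_convex S)
      (auto simp: inner_diff_right)
  show thesis
  proof (rule that[OF H])
    \<comment> \<open>A face of \<open>S\<close> that meets the relative interior of
      \<open>K\<close> contains all of \<open>K\<close>.\<close>
    show "K \<subseteq> H"
      using K eK eS by (intro subset_of_face_of[OF H face_of_imp_subset]) (auto simp: H_def)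
    show "z \<notin> H"
      using bA by (auto simp: H_def inner_diff_right)
    show "e + t *\<^sub>R ?q \<in> H"
      using t bq by (simp add: H_def inner_add_right)
  qed (use r0 t in auto)
qed

section \<open>Faces one dimension above \<open>K\<close>\<close>

lemma faces1_positive_direction:
  fixes P :: "'a::euclidean_space set"
  assumes P: "polyhedron P" and K: "K face_of P" and e: "e \<in> rel_interior K"
    and orth: "\<And>x. x \<in> K \<Longrightarrow> v \<bullet> (x - e) = 0"
    and x: "x \<in> P" "v \<bullet> (x - e) > 0"
  obtains G y where "G \<in> faces1 P K" "y \<in> G" "v \<bullet> (y - e) > 0"
proof -
  define Q where "Q = (\<lambda>G. G face_of P \<and> K \<subseteq> G \<and> (\<exists>y\<in>G. v \<bullet> (y - e) > 0))"
  have "Q P"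
    unfolding Q_def using P K x by (auto simp: face_of_refl polyhedron_imp_convex face_of_imp_subset)
  then obtain G where G: "Q G"
    and "\<forall>H. Q H \<longrightarrow> nat (aff_dim G + 1) \<le> nat (aff_dim H + 1)"
    using ex_has_least_nat[of Q P "\<lambda>G. nat (aff_dim G + 1)"] by blast
  then have Gmin: "aff_dim G \<le> aff_dim H" if "Q H" for H
    using that aff_dim_geq[of G] aff_dim_geq[of H] by fastforce
  from G obtain y where y: "y \<in> G" "v \<bullet> (y - e) > 0" and GP: "G face_of P" and KG: "K \<subseteq> G"
    unfolding Q_def by blast
  have G_poly: "polyhedron G"
    using P GP face_of_polyhedron_polyhedron by blast
  have KfG: "K face_of G"
    using face_of_subset[OF K KG face_of_imp_subset[OF GP]] .
  have eK: "e \<in> K"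
    using e rel_interior_subset by blast
  have "K \<noteq> G"
    using y orth by force
  have "aff_dim G - aff_dim K = 1"
  proof (rule ccontr)
    assume ne: "aff_dim G - aff_dim K \<noteq> 1"
    obtain H where H: "H facet_of G" "K \<subseteq> H"
      using face_of_polyhedron_subset_facet[OF G_poly KfG] eK \<open>K \<noteq> G\<close> by blast
    then have Hd: "aff_dim H = aff_dim G - 1" and HG: "H face_of G"
      by (auto simp: facet_of_def)
    \<comment> \<open>If the facet were \<open>K\<close> itself, the dimensions would differ by
      exactly one.\<close>
    then have "H \<noteq> K"
      using ne by auto
    then obtain z where z: "z \<in> H" "z \<notin> K"
      using H by blast
    have zG: "z \<in> G"
      using z HG face_of_imp_subset by blast
    \<comment> \<open>\<open>H\<close> has smaller dimension than \<open>G\<close>, so minimality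
      excludes positive values on it.\<close>
    have "\<not> Q H"
      using Gmin Hd by force
    then have vz: "v \<bullet> (z - e) \<le> 0"
      using z H HG GP unfolding Q_def by (meson face_of_trans not_less)
    obtain H' c t where H': "H' face_of G" "K \<subseteq> H'" "z \<notin> H'" and c: "c \<ge> 0" "t > 0"
      "e + t *\<^sub>R ((y - e) - c *\<^sub>R (z - e)) \<in> H'"
      using polyhedron_move_to_face[OF G_poly KfG e zG z(2) y(1)] by metis
    have "v \<bullet> (e + t *\<^sub>R ((y - e) - c *\<^sub>R (z - e)) - e) = t * (v \<bullet> (y - e) - c * (v \<bullet> (z - e)))"
      by (simp add: inner_diff_right[of v "y - e"])
    also have "\<dots> > 0"
      using c y vz by (intro mult_pos_pos) (smt (verit) mult_nonneg_nonpos)+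
    finally have "Q H'"
      unfolding Q_def using H' GP c(3) face_of_trans by blast
    \<comment> \<open>The point \<open>z\<close> of \<open>G\<close> is missing from
      \<open>H'\<close>, so this face is proper.\<close>
    moreover have "aff_dim H' < aff_dim G"
      using H' zG G_poly by (intro face_of_aff_dim_lt) (auto simp: polyhedron_imp_convex)
    ultimately show False
      using Gmin by force
  qed
  then have "G \<in> faces1 P K"
    using GP KG y by (auto simp: faces1_def nonempty_face_def)
  then show thesis
    using that y by blast
qed

text \<open>Adding \<open>y\<close> already raises the dimension of \<open>K\<close> by one, and
  nested sets of equal dimension have the same affine hull.\<close>

lemma affine_hull_faces1:
  assumes "G \<in> faces1 P K" "y \<in> G" "y \<notin> affine hull K"
  shows "affine hull G = affine hull (insert y K)"
proof -
  have "aff_dim (insert y K) = aff_dim G" "insert y K \<subseteq> G"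
    using assms by (auto simp: faces1_def aff_dim_insert)
  then show ?thesis
    by (metis aff_dim_eq_full_gen)
qed

text \<open>The direction to the projection is a multiple \<open>c\<close> of \<open>y - e\<close>
  plus a direction of \<open>K\<close>. The latter is harmless because \<open>e\<close> is
  relatively interior to \<open>K\<close>, so everything depends on the sign of
  \<open>c\<close>.\<close>

lemma faces1_escape_direction:
  fixes P :: "'a::euclidean_space set"
  assumes G: "G \<in> faces1 P K" and e: "e \<in> rel_interior K"
    and orth: "\<And>x. x \<in> affine hull K \<Longrightarrow> (p - e) \<bullet> (x - e) = 0"
    and y: "y \<in> G" "(p - e) \<bullet> (y - e) > 0"
  obtains t where "t > 0" "e + t *\<^sub>R (orth_proj (affine hull G) p - e) \<in> G"
    "orth_proj (affine hull G) p \<noteq> e"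
proof -
  define d where "d = orth_proj (affine hull G) p - e"
  have eK: "e \<in> K"
    using e rel_interior_subset by blast
  have KG: "K \<subseteq> G" and "convex G"
    using G by (auto simp: faces1_def nonempty_face_def face_of_def)
  have inner: "(p - e) \<bullet> (x - e) = d \<bullet> (x - e)" if "x \<in> affine hull G" for x
    unfolding d_def using that eK KG by (intro orth_proj_diff_inner) (auto simp: hull_inc)
  have "e + d \<in> affine hull G"
    using orth_proj_affine(1)[of "affine hull G" p] eK KG by (auto simp: d_def)
  have "d \<noteq> 0"
    using y inner[of y] by (auto simp: hull_inc)
  have "y \<notin> affine hull K"
    using y orth by force
  then have "e + d \<in> affine hull (insert e (insert y K))"
    using \<open>e + d \<in> affine hull G\<close> affine_hull_faces1[OF G y(1)] eK by (simp add: insert_absorb)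
  then have "d \<in> span ((\<lambda>x. x - e) ` insert y K)"
    by (auto simp: affine_hull_insert_span_gen)
  then obtain c where "d - c *\<^sub>R (y - e) \<in> span ((\<lambda>x. x - e) ` K)"
    by (auto simp: span_insert)
  then have "e + (d - c *\<^sub>R (y - e)) \<in> affine hull (insert e K)"
    by (auto simp: affine_hull_insert_span_gen)
  then have l: "e + (d - c *\<^sub>R (y - e)) \<in> affine hull K"
    using eK by (simp add: insert_absorb)
  \<comment> \<open>Pairing with \<open>p - e\<close> kills the component along \<open>K\<close>, so
    the positive square of \<open>d\<close> determines the sign of \<open>c\<close>.\<close>
  have "d \<bullet> d = (p - e) \<bullet> d"
    using inner[OF \<open>e + d \<in> affine hull G\<close>] by simp
  also have "\<dots> = c * ((p - e) \<bullet> (y - e))"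
    using orth[OF l] by (simp add: inner_diff_right[of "p - e" d])
  finally have "0 < c * ((p - e) \<bullet> (y - e))"
    using \<open>d \<noteq> 0\<close> by (metis inner_gt_zero_iff)
  then have "c > 0"
    using y by (simp add: zero_less_mult_iff)
  obtain s where s: "s > 0" "e + s *\<^sub>R (d - c *\<^sub>R (y - e)) \<in> K"
    using rel_interior_step[OF e l] by auto
  text \<open>\<open>e + t d\<close> lies in the triangle with vertices \<open>e\<close>, \<open>y\<close> and \<open>e + s (d - c (y - e))\<close>.\<close>
  define m where "m = 1 / (1 + s * c)"
  have m: "0 < m" "m \<le> 1" "1 - m = m * (s * c)"
    using s mult_pos_pos[OF s(1) \<open>c > 0\<close>] by (simp_all add: m_def divide_simps)
  have "(1 - m) *\<^sub>R y + m *\<^sub>R (e + s *\<^sub>R (d - c *\<^sub>R (y - e))) \<in> G"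
    using \<open>convex G\<close> y s KG m by (intro convexD) auto
  \<comment> \<open>The weight \<open>m\<close> is chosen so that the multiples of \<open>y\<close>
    cancel.\<close>
  moreover have "(1 - m) *\<^sub>R y + m *\<^sub>R (e + s *\<^sub>R (d - c *\<^sub>R (y - e))) =
    (m * (s * c) + m) *\<^sub>R e + (m * s) *\<^sub>R d"
    unfolding m(3) by (simp add: algebra_simps)
  moreover have "m * (s * c) + m = 1"
    using m(3) by simp
  ultimately have "e + (m * s) *\<^sub>R d \<in> G"
    by simp
  then show thesis
    using that[of "m * s"] s m \<open>d \<noteq> 0\<close> by (auto simp: d_def)
qed

theorem theorem1p3:
  fixes P F K :: "(real ^ 'n) set" and p e :: "real ^ 'n"
  assumes "polyhedron P"
    and "p \<notin> P"
    and "nonempty_face P F"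
    and "nonempty_face P K"
    and "nonempty_face F K" and "K \<noteq> F"
    and "e \<in> rel_interior K"
    and "\<exists>e'. is_escape P F p e e'"
  shows "(\<exists>e'. is_escape P K p e e') \<or> (\<exists>K'\<in>faces1 P K. \<exists>e'. is_escape P K' p e e')"
proof -
  note P = polyhedron_imp_closed[OF assms(1)] polyhedron_imp_convex[OF assms(1)]
  have K: "K face_of P" and eK: "e \<in> K"
    using assms rel_interior_subset by (auto simp: nonempty_face_def)
  have KP: "K \<subseteq> P"
    using K face_of_imp_subset by blast
  show ?thesis
  proof (cases "orth_proj (affine hull K) p = e")
    case False
    have "orth_proj (affine hull K) p \<in> affine hull K"
      using eK by (intro orth_proj_affine) auto
    then obtain t where "t > 0" "e + t *\<^sub>R (orth_proj (affine hull K) p - e) \<in> K"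
      using rel_interior_step[OF assms(7)] by blast
    then have "\<exists>e'. is_escape P K p e e'"
      using ex_escape_iff[OF P assms(4) eK] False KP by blast
    then show ?thesis ..
  next
    case True
    have orth: "(p - e) \<bullet> (x - e) = 0" if "x \<in> affine hull K" for x
      using orth_proj_affine(2)[of "affine hull K" x p] that eK True by auto
    define d where "d = orth_proj (affine hull F) p - e"
    have eF: "e \<in> F"
      using assms(8) by (auto simp: is_escape_def)
    obtain t where t: "d \<noteq> 0" "t > 0" "e + t *\<^sub>R d \<in> P"
      using assms(8) ex_escape_iff[OF P assms(3) eF] by (auto simp: d_def)
    have "e + d \<in> affine hull F"
      using orth_proj_affine(1)[of "affine hull F" p] eF by (auto simp: d_def)
    \<comment> \<open>As \<open>d\<close> is a direction of the hull of \<open>F\<close>,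
      \<open>p\<close> may be replaced by its projection. The escape along \<open>F\<close> thus has
      positive product with \<open>p - e\<close>.\<close>
    then have "(p - e) \<bullet> d = d \<bullet> d"
      using orth_proj_diff_inner[of "affine hull F" e "e + d" p] eF by (auto simp: d_def hull_inc)
    then have "(p - e) \<bullet> (e + t *\<^sub>R d - e) > 0"
      using t by simp
    then obtain G y where G: "G \<in> faces1 P K" and y: "y \<in> G" "(p - e) \<bullet> (y - e) > 0"
      using faces1_positive_direction[OF assms(1) K assms(7) _ t(3)] orth by (metis hull_inc)
    obtain s where "s > 0" "e + s *\<^sub>R (orth_proj (affine hull G) p - e) \<in> G"
      "orth_proj (affine hull G) p \<noteq> e"
      using faces1_escape_direction[OF G assms(7) orth y] by blast
    moreover have "nonempty_face P G" "G \<subseteq> P" "e \<in> G"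
      using G eK by (auto simp: faces1_def nonempty_face_def dest: face_of_imp_subset)
    ultimately have "\<exists>e'. is_escape P G p e e'"
      using ex_escape_iff[OF P] by blast
    then show ?thesis
      using G by blast
  qed
qed

end
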